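(* Let $\mathcal{S}$, $\mathcal{G}$ and $\mathcal{T}$ be the sets of all standard dynamical-lexicographic orderings, all general dynamical-lexicographic orderings, and all typical orderings on $\mathrm{Homeo}_+(\mathbb{R})$, respectively, and let $\mathcal{LO}(\mathrm{Homeo}_+(\mathbb{R}))$ be the set of all left-orderings on $\mathrm{Homeo}_+(\mathbb{R})$. Then the following strict inclusions hold: \[ \mathcal{S}\subsetneq \mathcal{G}\subsetneq \mathcal{T}\subsetneq \mathcal{LO}(\mathrm{Homeo}_+(\mathbb{R})). \]
   Context: $\mathrm{Homeo}_+(\mathbb{R})$ is the group (under composition) of orientation-preserving homeomorphisms of $\mathbb{R}$. A left-ordering on a group $G$ is a total order $\preceq$ on $G$ such that $f\prec g$ implies $hf\prec hg$ for all $f,g,h\in G$. An element is positive if it is strictly greater than the identity, negative if strictly smaller. Standard dynamical-lexicographic ordering: given a sequence $\mathbf{x}=(x_n)_{n=1}^\infty$ dense in $\mathbb{R}$ and $\Omega:\mathbb{N}\to\{+,-\}$, the ordering $\preceq_{\mathbf{x},\Omega}$ on $\mathrm{Homeo}_+(\mathbb{R})$ is defined, for $f\ne g$, by $f\succ g$ iff either $f(x_n)>g(x_n)$ and $\Omega(n)=+$, or $f(x_n)<g(x_n)$ and $\Omega(n)=-$, where $n$ is the smallest index with $f(x_n)\neq g(x_n)$. General dynamical-lexicographic ordering: given a well-ordering $\leq_w$ of the set $\mathbb{R}$ and $\Omega:\mathbb{R}\to\{+,-\}$, the ordering $\preceq_{\leq_w,\Omega}$ on $\mathrm{Homeo}_+(\mathbb{R})$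 is defined, for $f\neq g$, by $f\succ g$ iff either $f(x)>g(x)$ and $\Omega(x)=+$, or $f(x)<g(x)$ and $\Omega(x)=-$, where $x$ is the $\leq_w$-least point with $f(x)\ne g(x)$. For $f\in\mathrm{Homeo}_+(\mathbb{R})$ put $A_f=\{x\in\mathbb{R}: f(x)>x\}$ and $B_f=\{x\in\mathbb{R}: f(x)<x\}$. A left-ordering $\preceq$ on $\mathrm{Homeo}_+(\mathbb{R})$ is typical if the sign of each element depends only on these sets: whenever $A_f=A_g$ and $B_f=B_g$, the elements $f$ and $g$ have the same sign (both positive, both negative, or both equal to the identity) with respect to $\preceq$. *)

theory Defs
  imports "HOL-Analysis.Analysis" "HOL-Algebra.Group"
begin

text \<open>An ordering is represented by its reflexive relation: \<open>(f, g) \<in> r\<close> means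
  \<open>f\<close> is at most \<open>g\<close>.\<close>

definition less_wrt :: "'a rel \<Rightarrow> 'a \<Rightarrow> 'a \<Rightarrow> bool" where
  "less_wrt r f g \<longleftrightarrow> (f, g) \<in> r \<and> f \<noteq> g"

definition left_ordering :: "('a, 'b) monoid_scheme \<Rightarrow> 'a rel \<Rightarrow> bool" where
  "left_ordering G r \<longleftrightarrow>
     linear_order_on (carrier G) r \<and>
     (\<forall>f\<in>carrier G. \<forall>g\<in>carrier G. \<forall>h\<in>carrier G.
        less_wrt r f g \<longrightarrow> less_wrt r (h \<otimes>\<^bsub>G\<^esub> f) (h \<otimes>\<^bsub>G\<^esub> g))"

definition positive_wrt :: "('a, 'b) monoid_scheme \<Rightarrow> 'a rel \<Rightarrow> 'a \<Rightarrow> bool" where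
  "positive_wrt G r f \<longleftrightarrow> less_wrt r \<one>\<^bsub>G\<^esub> f"

definition negative_wrt :: "('a, 'b) monoid_scheme \<Rightarrow> 'a rel \<Rightarrow> 'a \<Rightarrow> bool" where
  "negative_wrt G r f \<longleftrightarrow> less_wrt r f \<one>\<^bsub>G\<^esub>"

definition Homeo_plus :: "(real \<Rightarrow> real) monoid" where
  "Homeo_plus =
     \<lparr>carrier = {f. (\<exists>g. homeomorphism UNIV UNIV f g) \<and> strict_mono f},
      mult = (\<lambda>f g. f \<circ> g), one = id\<rparr>"

lemma group_Homeo_plus: "group Homeo_plus"
proof (rule groupI)
  fix f g assume "f \<in> carrier Homeo_plus" "g \<in> carrier Homeo_plus"
  then obtain f' g' where h: "homeomorphism UNIV UNIV f f'" "homeomorphism UNIV UNIV g g'"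
    and m: "strict_mono f" "strict_mono g"
    by (auto simp: Homeo_plus_def)
  have "homeomorphism UNIV UNIV (f \<circ> g) (g' \<circ> f')"
    using homeomorphism_compose[OF h(2) h(1)] .
  moreover have "strict_mono (f \<circ> g)"
    using m by (rule strict_mono_o)
  ultimately show "f \<otimes>\<^bsub>Homeo_plus\<^esub> g \<in> carrier Homeo_plus"
    by (auto simp: Homeo_plus_def)
next
  have "homeomorphism (UNIV :: real set) UNIV id id"
    by (auto simp: homeomorphism_def)
  then show "\<one>\<^bsub>Homeo_plus\<^esub> \<in> carrier Homeo_plus"
    by (auto simp: Homeo_plus_def strict_mono_def)
next
  fix f assume "f \<in> carrier Homeo_plus"
  then obtain g where h: "homeomorphism UNIV UNIV f g" and m: "strict_mono f"
    by (auto simp: Homeo_plus_def)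
  have fg: "f (g x) = x" "g (f x) = x" for x
    using h by (auto simp: homeomorphism_def)
  have "strict_mono g"
    using m by (intro strict_monoI) (metis fg(1) strict_mono_less)
  then have "g \<in> carrier Homeo_plus"
    using homeomorphism_symD[OF h] by (auto simp: Homeo_plus_def)
  moreover have "g \<otimes>\<^bsub>Homeo_plus\<^esub> f = \<one>\<^bsub>Homeo_plus\<^esub>"
    using fg by (auto simp: Homeo_plus_def)
  ultimately show "\<exists>g\<in>carrier Homeo_plus. g \<otimes>\<^bsub>Homeo_plus\<^esub> f = \<one>\<^bsub>Homeo_plus\<^esub>"
    by blast
qed (auto simp: Homeo_plus_def)

datatype sign = Plus | Minus

text \<open>Sequences are indexed from \<open>0\<close> instead of \<open>1\<close>; the resulting set of orderings is
  the same.\<close>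

definition std_dynlex :: "(nat \<Rightarrow> real) \<Rightarrow> (nat \<Rightarrow> sign) \<Rightarrow> (real \<Rightarrow> real) rel" where
  "std_dynlex x \<Omega> =
     {(g, f). g \<in> carrier Homeo_plus \<and> f \<in> carrier Homeo_plus \<and>
        (f = g \<or>
         (\<exists>n. f (x n) \<noteq> g (x n) \<and> (\<forall>m. f (x m) \<noteq> g (x m) \<longrightarrow> n \<le> m) \<and>
              (f (x n) > g (x n) \<and> \<Omega> n = Plus \<or> f (x n) < g (x n) \<and> \<Omega> n = Minus)))}"

definition gen_dynlex :: "real rel \<Rightarrow> (real \<Rightarrow> sign) \<Rightarrow> (real \<Rightarrow> real) rel" where
  "gen_dynlex w \<Omega> =
     {(g, f). g \<in> carrier Homeo_plus \<and> f \<in> carrier Homeo_plus \<and>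
        (f = g \<or>
         (\<exists>x. f x \<noteq> g x \<and> (\<forall>y. f y \<noteq> g y \<longrightarrow> (x, y) \<in> w) \<and>
              (f x > g x \<and> \<Omega> x = Plus \<or> f x < g x \<and> \<Omega> x = Minus)))}"

definition standard_orderings :: "(real \<Rightarrow> real) rel set" where
  "standard_orderings = {std_dynlex x \<Omega> |x \<Omega>. closure (range x) = UNIV}"

definition general_orderings :: "(real \<Rightarrow> real) rel set" where
  "general_orderings = {gen_dynlex w \<Omega> |w \<Omega>. well_order_on UNIV w}"

definition above_set :: "(real \<Rightarrow> real) \<Rightarrow> real set" where
  "above_set f = {x. f x > x}"

definition below_set :: "(real \<Rightarrow> real) \<Rightarrow> real set" where
  "below_set f = {x. f x < x}"

definition left_orderings :: "('a, 'b) monoid_scheme \<Rightarrow> 'a rel set" where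
  "left_orderings G = {r. left_ordering G r}"

definition typical_orderings :: "(real \<Rightarrow> real) rel set" where
  "typical_orderings =
     {r. left_ordering Homeo_plus r \<and>
         (\<forall>f\<in>carrier Homeo_plus. \<forall>g\<in>carrier Homeo_plus.
            above_set f = above_set g \<and> below_set f = below_set g \<longrightarrow>
              positive_wrt Homeo_plus r f \<and> positive_wrt Homeo_plus r g \<or>
              negative_wrt Homeo_plus r f \<and> negative_wrt Homeo_plus r g \<or>
              f = \<one>\<^bsub>Homeo_plus\<^esub> \<and> g = \<one>\<^bsub>Homeo_plus\<^esub>)}"

end

theory Submission
  imports Defs
begin

text \<open>
  The inclusions are soft. A sequence dense in the line is completed to a well-ordering of the
  whole line by listing its points first, in the order of first appearance; by continuity, two
  different homeomorphisms already differ at one of these points, so nothing after them matters.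
  A general ordering compares \<open>f\<close> with the identity at the least point that \<open>f\<close> moves, and both
  this point and the direction in which it moves can be read off from the sets of points moved up
  and down.

  Each strictness claim is a matter of finding an ordering in which a different part of the line
  has priority.

  \<^item> General but not standard (\<open>ex_general_not_standard\<close>): let all negative points precede all
    others. In a dense sequence, only finitely many points \<open>x\<^sub>0, \<dots>, x\<^sub>n\<^sub>-\<^sub>1\<close> come before the first
    positive one, \<open>x\<^sub>n\<close>. Move \<open>x\<^sub>n\<close> up and move an interval of negative points, chosen to avoid
    the finite list, either up or down. A standard ordering sees only \<open>x\<^sub>n\<close> and gives both
    homeomorphisms the same sign; the general ordering sees the negative interval first and
    separates them.

  \<^item> Typical but not general (\<open>germ_first_typical\<close>, \<open>germ_first_not_general\<close>): compare germs at
    infinity along an ultrafilter, and only on ties use a general ordering. This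
    amounts to evaluating homeomorphisms at an infinite point of an ultrapower of the line, so
    whether the point moves up or down still depends only on the sets of points moved up and down.
    But in a general ordering the least real point overrules whatever happens near infinity.

  \<^item> Not typical (\<open>galaxy_first_not_typical\<close>): let \<open>\<xi>\<close> be that infinite point. Compare first
    the images of the cut above the galaxy of \<open>\<xi>\<close>, that is, above all points at finite distance from
    \<open>\<xi>\<close>, and on ties compare the images of \<open>\<xi>\<close> itself, in \<^emph>\<open>reversed\<close> order. A translation to the
    right fixes the cut and is therefore negative, while a map that is eventually \<open>x \<mapsto> 2x\<close> moves the
    cut up and is positive. Yet both can be chosen to move every point of the line up.

  The last two orderings are lexicographic products of left-invariant total preorders, which are
  left-orderings for general reasons (\<open>left_ordering_lex_order\<close>).
\<close>

section \<open>Left-invariant preorders and their lexicographic products\<close>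

definition left_preorder :: "('a, 'b) monoid_scheme \<Rightarrow> ('a \<Rightarrow> 'a \<Rightarrow> bool) \<Rightarrow> bool" where
  "left_preorder G L \<longleftrightarrow>
     (\<forall>f\<in>carrier G. \<forall>g\<in>carrier G. L f g \<or> L g f) \<and>
     (\<forall>f\<in>carrier G. \<forall>g\<in>carrier G. \<forall>h\<in>carrier G. L f g \<longrightarrow> L g h \<longrightarrow> L f h) \<and>
     (\<forall>f\<in>carrier G. \<forall>g\<in>carrier G. \<forall>h\<in>carrier G.
        L f g \<longrightarrow> L (h \<otimes>\<^bsub>G\<^esub> f) (h \<otimes>\<^bsub>G\<^esub> g))"

definition lex_order :: "('a, 'b) monoid_scheme \<Rightarrow> ('a \<Rightarrow> 'a \<Rightarrow> bool) \<Rightarrow> 'a rel \<Rightarrow> 'a rel" where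
  "lex_order G L r =
     {(f, g). f \<in> carrier G \<and> g \<in> carrier G \<and> L f g \<and> (L g f \<longrightarrow> (f, g) \<in> r)}"

lemma left_preorder_reverse:
  "left_preorder G L \<Longrightarrow> left_preorder G (\<lambda>f g. L g f)"
  unfolding left_preorder_def by blast

text \<open>Multiplication by inverses makes invariance an equivalence, so that left multiplication also
  preserves strict inequalities and ties.\<close>

lemma left_preorder_cancel:
  assumes "group G" "left_preorder G L" "f \<in> carrier G" "g \<in> carrier G" "h \<in> carrier G"
  shows "L (h \<otimes>\<^bsub>G\<^esub> f) (h \<otimes>\<^bsub>G\<^esub> g) \<longleftrightarrow> L f g"
proof
  interpret group G by fact
  assume "L (h \<otimes>\<^bsub>G\<^esub> f) (h \<otimes>\<^bsub>G\<^esub> g)"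
  moreover have "h \<otimes>\<^bsub>G\<^esub> f \<in> carrier G" "h \<otimes>\<^bsub>G\<^esub> g \<in> carrier G" "inv\<^bsub>G\<^esub> h \<in> carrier G"
    using assms(3-5) by simp_all
  ultimately have "L (inv\<^bsub>G\<^esub> h \<otimes>\<^bsub>G\<^esub> (h \<otimes>\<^bsub>G\<^esub> f)) (inv\<^bsub>G\<^esub> h \<otimes>\<^bsub>G\<^esub> (h \<otimes>\<^bsub>G\<^esub> g))"
    using assms(2) unfolding left_preorder_def by blast
  then show "L f g"
    using assms(3-5) by (simp flip: m_assoc)
next
  assume "L f g"
  then show "L (h \<otimes>\<^bsub>G\<^esub> f) (h \<otimes>\<^bsub>G\<^esub> g)"
    using assms unfolding left_preorder_def by blast
qed

text \<open>Left multiplication maps ties of \<open>L\<close> to ties and strict inequalities to strict ones, so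
  a pair and all its left translates are decided by the same one of \<open>L\<close> and \<open>r\<close>.\<close>

lemma left_ordering_lex_order:
  assumes G: "group G" and L: "left_preorder G L" and r: "left_ordering G r"
  shows "left_ordering G (lex_order G L r)"
proof -
  have lin: "linear_order_on (carrier G) r"
    using r by (simp add: left_ordering_def)
  have "refl_on (carrier G) (lex_order G L r)"
    using L lin unfolding refl_on_def lex_order_def left_preorder_def order_on_defs by blast
  moreover have "trans (lex_order G L r)"
    unfolding trans_def
  proof (intro allI impI)
    fix f g h assume fg: "(f, g) \<in> lex_order G L r" and gh: "(g, h) \<in> lex_order G L r"
    then have c: "f \<in> carrier G" "g \<in> carrier G" "h \<in> carrier G" and l: "L f g" "L g h"
      by (auto simp: lex_order_def)
    have fh: "L f h"
      using L c l unfolding left_preorder_def by blast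
    have "(f, h) \<in> r" if "L h f"
    proof -
      have "L g f" "L h g"
        using L c l that unfolding left_preorder_def by blast+
      then have "(f, g) \<in> r" "(g, h) \<in> r"
        using fg gh by (auto simp: lex_order_def)
      then show ?thesis
        using lin unfolding order_on_defs trans_def by blast
    qed
    with c fh show "(f, h) \<in> lex_order G L r"
      by (simp add: lex_order_def)
  qed
  moreover have "antisym (lex_order G L r)"
    using lin unfolding antisym_def lex_order_def order_on_defs by blast
  moreover have "total_on (carrier G) (lex_order G L r)"
    using L lin unfolding total_on_def lex_order_def left_preorder_def order_on_defs by blast
  moreover have "lex_order G L r \<subseteq> carrier G \<times> carrier G"
    by (auto simp: lex_order_def)
  ultimately have "linear_order_on (carrier G) (lex_order G L r)"
    by (simp add: order_on_defs)
  moreover have "less_wrt (lex_order G L r) (h \<otimes>\<^bsub>G\<^esub> f) (h \<otimes>\<^bsub>G\<^esub> g)"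
    if c: "f \<in> carrier G" "g \<in> carrier G" "h \<in> carrier G"
      and "less_wrt (lex_order G L r) f g" for f g h
  proof -
    interpret group G by (rule G)
    have inv: "L g f \<longrightarrow> less_wrt r f g" "L f g" "f \<noteq> g"
      using that by (auto simp: less_wrt_def lex_order_def)
    then have "L g f \<longrightarrow> less_wrt r (h \<otimes>\<^bsub>G\<^esub> f) (h \<otimes>\<^bsub>G\<^esub> g)"
      using r c by (auto simp: left_ordering_def)
    then show ?thesis
      using inv c left_preorder_cancel[OF G L] by (auto simp: less_wrt_def lex_order_def)
  qed
  ultimately show ?thesis
    by (simp add: left_ordering_def)
qed

section \<open>Orientation-preserving homeomorphisms of the line\<close>

lemma Homeo_plus_simps [simp]:
  "mult Homeo_plus = (\<circ>)" "one Homeo_plus = id"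
  by (simp_all add: Homeo_plus_def)

lemma id_in_Homeo_plus: "id \<in> carrier Homeo_plus"
  using monoid.one_closed[OF group.is_monoid[OF group_Homeo_plus]] by simp

lemma Homeo_plus_comp:
  "f \<in> carrier Homeo_plus \<Longrightarrow> g \<in> carrier Homeo_plus \<Longrightarrow> f \<circ> g \<in> carrier Homeo_plus"
  using monoid.m_closed[OF group.is_monoid[OF group_Homeo_plus]] by simp

lemma Homeo_plus_strict_mono: "f \<in> carrier Homeo_plus \<Longrightarrow> strict_mono f"
  by (simp add: Homeo_plus_def)

lemma Homeo_plus_less_iff: "f \<in> carrier Homeo_plus \<Longrightarrow> f x < f y \<longleftrightarrow> x < y"
  by (simp add: Homeo_plus_strict_mono strict_mono_less)

lemma Homeo_plus_le_iff: "f \<in> carrier Homeo_plus \<Longrightarrow> f x \<le> f y \<longleftrightarrow> x \<le> y"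
  by (simp add: Homeo_plus_strict_mono strict_mono_less_eq)

lemma Homeo_plus_eq_iff: "f \<in> carrier Homeo_plus \<Longrightarrow> f x = f y \<longleftrightarrow> x = y"
  by (simp add: Homeo_plus_strict_mono strict_mono_eq)

lemma Homeo_plus_continuous: "f \<in> carrier Homeo_plus \<Longrightarrow> continuous_on UNIV f"
  by (auto simp: Homeo_plus_def homeomorphism_def)

text \<open>Continuity comes for free: a monotone map of the line with open range cannot jump, and this
  applies to the map as well as to its inverse.\<close>

lemma strict_mono_right_inverse_in_Homeo_plus:
  fixes f :: "real \<Rightarrow> real"
  assumes mono: "strict_mono f" and fg: "\<And>y. f (g y) = y"
  shows "f \<in> carrier Homeo_plus"
proof -
  have gf: "g (f x) = x" for x
    using fg[of "f x"] mono by (simp add: strict_mono_eq)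
  have mono_g: "g x \<le> g y" if "x \<le> y" for x y
    using that fg mono by (metis strict_mono_less_eq)
  have surj: "range f = UNIV" "range g = UNIV"
    using surjI[of f g] surjI[of g f] fg gf by auto
  have "continuous_on UNIV f" "continuous_on UNIV g"
    using mono mono_g surj by (auto intro!: continuous_onI_mono simp: strict_mono_less_eq)
  then have "homeomorphism UNIV UNIV f g"
    using surj fg gf by (auto simp: homeomorphism_def)
  with mono show ?thesis
    by (auto simp: Homeo_plus_def)
qed

lemma strict_mono_surj_in_Homeo_plus:
  fixes f :: "real \<Rightarrow> real"
  assumes "strict_mono f" "surj f"
  shows "f \<in> carrier Homeo_plus"
  using assms by (metis strict_mono_right_inverse_in_Homeo_plus surj_f_inv_f)

lemma affine_in_Homeo_plus:
  assumes "0 < a"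
  shows "(\<lambda>x. a * x + b) \<in> carrier Homeo_plus"
  using assms
  by (intro strict_mono_right_inverse_in_Homeo_plus[where g = "\<lambda>y. (y - b) / a"])
    (auto simp: strict_mono_def)

text \<open>The identity plus or minus half a tent over the interval from \<open>a\<close> to \<open>b\<close>: the tent has
  slopes \<open>1\<close> and \<open>-1\<close>, so with \<open>s = 1\<close> or \<open>s = -1\<close> the result has slopes \<open>1/2\<close>, \<open>1\<close> and
  \<open>3/2\<close> and stays increasing, and exactly the open interval is moved, in the direction of \<open>s\<close>.\<close>

definition bump :: "real \<Rightarrow> real \<Rightarrow> real \<Rightarrow> real \<Rightarrow> real" where
  "bump s a b x = x + s * max 0 (min (x - a) (b - x)) / 2"

lemma bump_in_Homeo_plus:
  assumes s: "s = 1 \<or> s = - 1"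
  shows "bump s a b \<in> carrier Homeo_plus"
proof (rule strict_mono_surj_in_Homeo_plus)
  show "strict_mono (bump s a b)"
  proof (rule strict_monoI)
    fix x y :: real assume "x < y"
    with s show "bump s a b x < bump s a b y"
      unfolding bump_def max_def min_def by (elim disjE; simp; argo)
  qed
  show "surj (bump s a b)"
    unfolding surj_def eq_commute[of _ "bump s a b _"]
  proof
    fix y
    show "\<exists>x. bump s a b x = y"
    proof (cases "a < y \<and> y < b")
      case True
      have "continuous_on {a..b} (bump s a b)"
        unfolding bump_def by (intro continuous_intros) simp
      moreover have "bump s a b a = a" "bump s a b b = b"
        using True by (auto simp: bump_def)
      ultimately show ?thesis
        using True IVT'[of "bump s a b" a y b] by auto
    next
      case False
      then have "bump s a b y = y"
        by (auto simp: bump_def max_def min_def)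
      then show ?thesis ..
    qed
  qed
qed

lemma bump_less_iff: "bump (- 1) a b x < x \<longleftrightarrow> a < x \<and> x < b"
  and bump_greater_iff: "x < bump 1 a b x \<longleftrightarrow> a < x \<and> x < b"
  and bump_neq_iff: "s = 1 \<or> s = - 1 \<Longrightarrow> bump s a b x \<noteq> x \<longleftrightarrow> a < x \<and> x < b"
  by (auto simp: bump_def max_def min_def)

section \<open>General dynamical-lexicographic orderings are typical\<close>

lemma well_order_on_UNIV_least:
  assumes w: "well_order_on UNIV w" and "P z"
  obtains y where "P y" "\<And>u. P u \<Longrightarrow> (y, u) \<in> w"
proof -
  have wf: "wf (w - Id)" and tot: "total_on UNIV w" and rfl: "refl_on UNIV w"
    using w by (auto simp: order_on_defs)
  from wf \<open>P z\<close> obtain y where y: "P y" "\<And>u. (u, y) \<in> w - Id \<Longrightarrow> \<not> P u"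
    using wfE_min[of "w - Id" z "Collect P"] by auto
  have "(y, u) \<in> w" if "P u" for u
    using y(2)[of u] that tot rfl by (cases "u = y") (auto simp: total_on_def refl_on_def)
  with y(1) show ?thesis
    by (rule that)
qed

text \<open>By antisymmetry the deciding point is unique, so any point known to be the least point of
  disagreement can be used to evaluate the ordering.\<close>

lemma gen_dynlex_iff:
  assumes w: "antisym w" and c: "f \<in> carrier Homeo_plus" "g \<in> carrier Homeo_plus"
    and x: "f x \<noteq> g x" "\<And>y. f y \<noteq> g y \<Longrightarrow> (x, y) \<in> w"
  shows "(g, f) \<in> gen_dynlex w \<Omega> \<longleftrightarrow> f x > g x \<and> \<Omega> x = Plus \<or> f x < g x \<and> \<Omega> x = Minus"
proof -
  have "y = x" if "f y \<noteq> g y" "\<forall>z. f z \<noteq> g z \<longrightarrow> (y, z) \<in> w" for y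
    using w x that by (auto dest: antisymD)
  moreover have "f \<noteq> g"
    using x(1) by auto
  ultimately show ?thesis
    using x c unfolding gen_dynlex_def mem_Collect_eq prod.case by blast
qed

text \<open>The order is left-invariant because an increasing map \<open>h\<close> changes neither the points where
  \<open>f\<close> and \<open>g\<close> disagree nor which of them is larger there.\<close>

lemma left_ordering_gen_dynlex:
  assumes w: "well_order_on UNIV w"
  shows "left_ordering Homeo_plus (gen_dynlex w \<Omega>)"
proof -
  let ?r = "gen_dynlex w \<Omega>"
  have anti_w: "antisym w" and trans_w: "trans w"
    using w by (auto simp: order_on_defs)
  have least: "\<exists>x. f x \<noteq> g x \<and> (\<forall>y. f y \<noteq> g y \<longrightarrow> (x, y) \<in> w)" if "f \<noteq> g"
    for f g :: "real \<Rightarrow> real"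
    using that well_order_on_UNIV_least[OF w, of "\<lambda>x. f x \<noteq> g x"] by (metis ext)
  have "trans ?r"
    unfolding trans_def
  proof (intro allI impI)
    fix f g h assume fg: "(f, g) \<in> ?r" and gh: "(g, h) \<in> ?r"
    show "(f, h) \<in> ?r"
    proof (cases "f = g \<or> g = h")
      case True
      with fg gh show ?thesis by auto
    next
      case False
      have c: "f \<in> carrier Homeo_plus" "g \<in> carrier Homeo_plus" "h \<in> carrier Homeo_plus"
        using fg gh by (auto simp: gen_dynlex_def)
      obtain x where x: "g x \<noteq> f x" "\<And>y. g y \<noteq> f y \<Longrightarrow> (x, y) \<in> w"
        using least[of g f] False by auto
      obtain x' where x': "h x' \<noteq> g x'" "\<And>y. h y \<noteq> g y \<Longrightarrow> (x', y) \<in> w"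
        using least[of h g] False by auto
      have s: "g x > f x \<and> \<Omega> x = Plus \<or> g x < f x \<and> \<Omega> x = Minus"
        using fg gen_dynlex_iff[OF anti_w c(2,1) x] by simp
      have s': "h x' > g x' \<and> \<Omega> x' = Plus \<or> h x' < g x' \<and> \<Omega> x' = Minus"
        using gh gen_dynlex_iff[OF anti_w c(3,2) x'] by simp
      \<comment> \<open>The first point where \<open>f\<close> and \<open>h\<close> differ is the earlier of the points \<open>x\<close>
        and \<open>x'\<close>.\<close>
      consider "x = x'" | "x \<noteq> x'" "(x, x') \<in> w" | "x \<noteq> x'" "(x', x) \<in> w"
        using w by (auto simp: order_on_defs total_on_def)
      then obtain z where z: "h z > f z \<and> \<Omega> z = Plus \<or> h z < f z \<and> \<Omega> z = Minus"
        and zw: "(z, x) \<in> w" "(z, x') \<in> w"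
      proof cases
        case 1
        then show ?thesis
          using that[of x] s s' w by (force simp: order_on_defs refl_on_def)
      next
        case 2
        then have "h x = g x"
          using x'(2)[of x] anti_w by (auto dest: antisymD)
        then show ?thesis
          using that[of x] s w 2 by (auto simp: order_on_defs refl_on_def)
      next
        case 3
        then have "g x' = f x'"
          using x(2)[of x'] anti_w by (auto dest: antisymD)
        then show ?thesis
          using that[of x'] s' w 3 by (auto simp: order_on_defs refl_on_def)
      qed
      have "(z, y) \<in> w" if "h y \<noteq> f y" for y
        using that x(2)[of y] x'(2)[of y] zw trans_w by (metis transD)
      then show ?thesis
        using gen_dynlex_iff[OF anti_w c(3,1), of z] z by auto
    qed
  qed
  moreover have "antisym ?r"
  proof (rule antisymI)
    fix f g assume fg: "(f, g) \<in> ?r" "(g, f) \<in> ?r"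
    then have c: "f \<in> carrier Homeo_plus" "g \<in> carrier Homeo_plus"
      by (auto simp: gen_dynlex_def)
    show "f = g"
    proof (rule ccontr)
      assume "f \<noteq> g"
      then obtain x where x: "f x \<noteq> g x" "\<And>y. f y \<noteq> g y \<Longrightarrow> (x, y) \<in> w"
        using least by blast
      have x': "g x \<noteq> f x" "\<And>y. g y \<noteq> f y \<Longrightarrow> (x, y) \<in> w"
        using x by metis+
      show False
        using fg gen_dynlex_iff[OF anti_w c x, of \<Omega>] gen_dynlex_iff[OF anti_w c(2,1) x', of \<Omega>]
        by auto
    qed
  qed
  moreover have "total_on (carrier Homeo_plus) ?r"
  proof (rule total_onI)
    fix f g assume c: "f \<in> carrier Homeo_plus" "g \<in> carrier Homeo_plus" and "f \<noteq> g"
    then obtain x where x: "f x \<noteq> g x" "\<And>y. f y \<noteq> g y \<Longrightarrow> (x, y) \<in> w"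
      using least by blast
    have x': "g x \<noteq> f x" "\<And>y. g y \<noteq> f y \<Longrightarrow> (x, y) \<in> w"
      using x by metis+
    show "(f, g) \<in> ?r \<or> (g, f) \<in> ?r"
      using x(1) gen_dynlex_iff[OF anti_w c x, of \<Omega>] gen_dynlex_iff[OF anti_w c(2,1) x', of \<Omega>]
      by (cases "\<Omega> x") auto
  qed
  moreover have "?r \<subseteq> carrier Homeo_plus \<times> carrier Homeo_plus"
    and "refl_on (carrier Homeo_plus) ?r"
    by (auto simp: gen_dynlex_def refl_on_def)
  ultimately have "linear_order_on (carrier Homeo_plus) ?r"
    by (simp add: order_on_defs)
  moreover have "less_wrt ?r (h \<circ> f) (h \<circ> g)"
    if c: "f \<in> carrier Homeo_plus" "g \<in> carrier Homeo_plus" "h \<in> carrier Homeo_plus"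
      and "less_wrt ?r f g" for f g h
  proof -
    have fg: "(f, g) \<in> ?r" "f \<noteq> g"
      using that by (auto simp: less_wrt_def)
    then obtain x where x: "g x \<noteq> f x" "\<And>y. g y \<noteq> f y \<Longrightarrow> (x, y) \<in> w"
      using least[of g f] by auto
    have hx: "(h \<circ> g) x \<noteq> (h \<circ> f) x" "\<And>y. (h \<circ> g) y \<noteq> (h \<circ> f) y \<Longrightarrow> (x, y) \<in> w"
      using x c by (auto simp: Homeo_plus_eq_iff)
    have "(h \<circ> f, h \<circ> g) \<in> ?r \<longleftrightarrow> (f, g) \<in> ?r"
      using gen_dynlex_iff[OF anti_w c(2,1), of x \<Omega>] x c
        gen_dynlex_iff[OF anti_w Homeo_plus_comp[OF c(3,2)] Homeo_plus_comp[OF c(3,1)], of x \<Omega>] hx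
      by (simp add: Homeo_plus_less_iff)
    with fg(1) have "(h \<circ> f, h \<circ> g) \<in> ?r"
      by simp
    with hx(1) show ?thesis
      unfolding less_wrt_def by metis
  qed
  ultimately show ?thesis
    by (simp add: left_ordering_def)
qed

text \<open>Positivity, negativity and being the identity exclude each other in a left-ordering and cover
  all cases, and the identity is recognised by its empty sets of moved points. Agreement of
  signs therefore reduces to agreement of the two comparisons with the identity, a form that is
  easy to check for lexicographic products.\<close>

lemma typical_ordering_iff:
  "r \<in> typical_orderings \<longleftrightarrow> left_ordering Homeo_plus r \<and>
     (\<forall>f\<in>carrier Homeo_plus. \<forall>g\<in>carrier Homeo_plus.
        above_set f = above_set g \<and> below_set f = below_set g \<longrightarrow>
          ((id, f) \<in> r \<longleftrightarrow> (id, g) \<in> r) \<and> ((f, id) \<in> r \<longleftrightarrow> (g, id) \<in> r))"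
  (is "_ \<longleftrightarrow> ?L r \<and> ?T r")
proof (cases "?L r")
  case True
  then have refl: "(id, id) \<in> r" and anti: "\<And>f. (f, id) \<in> r \<Longrightarrow> (id, f) \<in> r \<Longrightarrow> f = id"
    and tot: "\<And>f. f \<in> carrier Homeo_plus \<Longrightarrow> (f, id) \<in> r \<or> (id, f) \<in> r"
    using id_in_Homeo_plus
    unfolding left_ordering_def order_on_defs refl_on_def antisym_def total_on_def by metis+
  have id_eq: "above_set f = {} \<and> below_set f = {} \<longleftrightarrow> f = id" for f
    by (auto simp: above_set_def below_set_def fun_eq_iff not_less intro: antisym)
  have "(positive_wrt Homeo_plus r f \<and> positive_wrt Homeo_plus r g \<or>
         negative_wrt Homeo_plus r f \<and> negative_wrt Homeo_plus r g \<or> f = id \<and> g = id) \<longleftrightarrow>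
      ((id, f) \<in> r \<longleftrightarrow> (id, g) \<in> r) \<and> ((f, id) \<in> r \<longleftrightarrow> (g, id) \<in> r)"
    if "f \<in> carrier Homeo_plus" "g \<in> carrier Homeo_plus"
      "above_set f = above_set g" "below_set f = below_set g" for f g
  proof -
    have "f = id \<longleftrightarrow> g = id"
      using that(3,4) id_eq by metis
    then show ?thesis
      using refl anti[of f] anti[of g] tot[OF that(1)] tot[OF that(2)]
      unfolding positive_wrt_def negative_wrt_def less_wrt_def Homeo_plus_simps by metis
  qed
  then show ?thesis
    unfolding typical_orderings_def Homeo_plus_simps by blast
next
  case False
  then show ?thesis
    by (simp add: typical_orderings_def)
qed

lemma gen_dynlex_typical:
  assumes w: "well_order_on UNIV w"
  shows "gen_dynlex w \<Omega> \<in> typical_orderings"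
proof -
  have pos: "(id, f) \<in> gen_dynlex w \<Omega> \<longleftrightarrow> f \<in> carrier Homeo_plus \<and>
      (above_set f = {} \<and> below_set f = {} \<or>
       (\<exists>x \<in> above_set f \<union> below_set f. (\<forall>y \<in> above_set f \<union> below_set f. (x, y) \<in> w) \<and>
          (x \<in> above_set f \<and> \<Omega> x = Plus \<or> x \<in> below_set f \<and> \<Omega> x = Minus)))" for f
    using id_in_Homeo_plus unfolding gen_dynlex_def above_set_def below_set_def
    by (auto simp: fun_eq_iff neq_iff)
  have neg: "(f, id) \<in> gen_dynlex w \<Omega> \<longleftrightarrow> f \<in> carrier Homeo_plus \<and>
      (above_set f = {} \<and> below_set f = {} \<or>
       (\<exists>x \<in> above_set f \<union> below_set f. (\<forall>y \<in> above_set f \<union> below_set f. (x, y) \<in> w) \<and>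
          (x \<in> below_set f \<and> \<Omega> x = Plus \<or> x \<in> above_set f \<and> \<Omega> x = Minus)))" for f
    using id_in_Homeo_plus unfolding gen_dynlex_def above_set_def below_set_def
    by (auto simp: fun_eq_iff neq_iff)
  show ?thesis
    using left_ordering_gen_dynlex[OF w] by (simp add: typical_ordering_iff pos neg)
qed

section \<open>Well-orders sorted by a rank\<close>

text \<open>A way to prescribe which points of a well-order come first: the rank decides, and \<open>w\<close>
  only arranges the points of equal rank.\<close>

definition sorted_by :: "('a \<Rightarrow> 'k::wellorder) \<Rightarrow> 'a rel \<Rightarrow> 'a rel" where
  "sorted_by k w = {(a, b). k a < k b \<or> k a = k b \<and> (a, b) \<in> w}"

lemma well_order_sorted_by:
  assumes w: "well_order_on UNIV w"
  shows "well_order_on UNIV (sorted_by k w)"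
proof -
  have "wf (inv_image ({(x, y). x < y} <*lex*> (w - Id)) (\<lambda>a. (k a, a)))"
    using w by (intro wf_inv_image wf_lex_prod wf) (simp add: order_on_defs)
  then have "wf (sorted_by k w - Id)"
    by (rule wf_subset) (auto simp: sorted_by_def)
  moreover have "trans (sorted_by k w)"
    using w unfolding trans_def sorted_by_def order_on_defs
    by clarsimp (metis order_less_trans)
  moreover have "antisym (sorted_by k w)"
    using w unfolding antisym_def sorted_by_def order_on_defs by auto
  moreover have "total_on UNIV (sorted_by k w)"
    using w unfolding total_on_def sorted_by_def order_on_defs by auto
  moreover have "refl (sorted_by k w)"
    using w unfolding refl_on_def sorted_by_def order_on_defs by auto
  ultimately show ?thesis
    by (simp add: order_on_defs)
qed

section \<open>Standard orderings form a proper subset of the general ones\<close>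

lemma std_dynlex_iff:
  assumes c: "f \<in> carrier Homeo_plus" "g \<in> carrier Homeo_plus"
    and n: "f (x n) \<noteq> g (x n)" "\<And>m. f (x m) \<noteq> g (x m) \<Longrightarrow> n \<le> m"
  shows "(g, f) \<in> std_dynlex x \<Omega> \<longleftrightarrow>
    f (x n) > g (x n) \<and> \<Omega> n = Plus \<or> f (x n) < g (x n) \<and> \<Omega> n = Minus"
proof -
  have "m = n" if "f (x m) \<noteq> g (x m)" "\<forall>k. f (x k) \<noteq> g (x k) \<longrightarrow> m \<le> k" for m
    using n that by (simp add: antisym)
  moreover have "f \<noteq> g"
    using n(1) by auto
  ultimately show ?thesis
    using n c unfolding std_dynlex_def mem_Collect_eq prod.case by blast
qed

lemma continuous_eq_if_eq_on_dense:
  fixes f g :: "real \<Rightarrow> real"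
  assumes "continuous_on UNIV f" "continuous_on UNIV g" "closure (range x) = UNIV"
    and "\<And>n. f (x n) = g (x n)"
  shows "f = g"
proof -
  have "closed {z. f z = g z}"
    using assms(1,2) by (rule closed_Collect_eq)
  then have "closure (range x) \<subseteq> {z. f z = g z}"
    using assms(4) by (intro closure_minimal) auto
  with assms(3) show ?thesis
    by auto
qed

text \<open>The rank of a point is the index of its first appearance in the sequence, and infinity if it
  never appears. By density, the least point of disagreement always has finite rank.\<close>

lemma std_dynlex_general:
  assumes dense: "closure (range x) = UNIV"
  shows "std_dynlex x \<Omega> \<in> general_orderings"
proof -
  obtain w0 :: "real rel" where w0: "well_order_on UNIV w0"
    using well_order_on by blast
  define index where "index a = (LEAST n. x n = a)" for a
  define rank where "rank a = (if a \<in> range x then enat (index a) else \<infinity>)" for a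
  define w where "w = sorted_by rank w0"
  have w: "well_order_on UNIV w"
    unfolding w_def using w0 by (rule well_order_sorted_by)
  then have anti_w: "antisym w"
    by (simp add: order_on_defs)
  have "(g, f) \<in> std_dynlex x \<Omega> \<longleftrightarrow> (g, f) \<in> gen_dynlex w (\<lambda>a. \<Omega> (index a))" for f g
  proof (cases "f \<noteq> g \<and> f \<in> carrier Homeo_plus \<and> g \<in> carrier Homeo_plus")
    case True
    then have c: "f \<in> carrier Homeo_plus" "g \<in> carrier Homeo_plus" and "f \<noteq> g"
      by auto
    then obtain n0 where "f (x n0) \<noteq> g (x n0)"
      using continuous_eq_if_eq_on_dense[OF _ _ dense] Homeo_plus_continuous by metis
    then obtain n where n: "f (x n) \<noteq> g (x n)" "\<And>m. f (x m) \<noteq> g (x m) \<Longrightarrow> n \<le> m"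
      using exists_least_iff[of "\<lambda>n. f (x n) \<noteq> g (x n)"] by (metis not_le)
    \<comment> \<open>The sequence may repeat a point; the first index at which \<open>f\<close> and \<open>g\<close> disagree is
      nevertheless the first appearance of its point, so the signs match.\<close>
    have index_n: "index (x n) = n"
      unfolding index_def using n by (intro Least_equality) auto
    have "(x n, y) \<in> w" if y: "f y \<noteq> g y" for y
    proof (cases "y \<in> range x")
      case True
      then have "x (index y) = y"
        unfolding index_def by (auto intro: LeastI)
      then have "n \<le> index y" "n = index y \<Longrightarrow> y = x n"
        using n(2)[of "index y"] y by auto
      then show ?thesis
        using True index_n w0
        by (cases "n = index y") (auto simp: w_def sorted_by_def rank_def order_on_defs refl_on_def)
    next
      case False
      then show ?thesis
        by (auto simp: w_def sorted_by_def rank_def)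
    qed
    with n c anti_w index_n show ?thesis
      by (simp add: std_dynlex_iff[where n = n] gen_dynlex_iff[where x = "x n"])
  next
    case False
    then show ?thesis
      by (auto simp: std_dynlex_def gen_dynlex_def)
  qed
  then have "std_dynlex x \<Omega> = gen_dynlex w (\<lambda>a. \<Omega> (index a))"
    by auto
  with w show ?thesis
    by (auto simp: general_orderings_def)
qed

lemma interval_avoiding_finite:
  fixes F :: "real set"
  assumes "finite F"
  obtains a b where "a < b" "b \<le> c" "\<And>y. y \<in> F \<Longrightarrow> \<not> (a < y \<and> y < b)"
proof -
  define a where "a = Min (insert c F) - 1"
  have "a + 1 \<le> c" "\<And>y. y \<in> F \<Longrightarrow> a + 1 \<le> y"
    using assms by (simp_all add: a_def)
  then show ?thesis
    using that[of a "a + 1"] by force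
qed

text \<open>Negative points precede all others in \<open>w\<close>. The map \<open>f s\<close> moves points of a negative interval
  in the direction \<open>s\<close>, and every positive point up. The ordering of \<open>w\<close> sees the direction
  \<open>s\<close>; a standard one, whose first \<open>n\<close> points are fixed, sees only that \<open>x n\<close> moves up.\<close>

lemma ex_general_not_standard: "\<exists>r \<in> general_orderings. r \<notin> standard_orderings"
proof -
  obtain w0 :: "real rel" where w0: "well_order_on UNIV w0"
    using well_order_on by blast
  define w where "w = sorted_by (\<lambda>a::real. if a < 0 then 0 else 1 :: nat) w0"
  define r where "r = gen_dynlex w (\<lambda>_. Plus)"
  have w: "well_order_on UNIV w"
    unfolding w_def using w0 by (rule well_order_sorted_by)
  then have anti_w: "antisym w"
    by (simp add: order_on_defs)
  have "r \<noteq> std_dynlex x \<Omega>" if dense: "closure (range x) = UNIV" for x \<Omega>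
  proof
    assume eq: "r = std_dynlex x \<Omega>"
    have "\<exists>n. 0 < x n"
    proof (rule ccontr)
      assume "\<not> (\<exists>n. 0 < x n)"
      then have "closure (range x) \<subseteq> {..0}"
        by (intro closure_minimal) (auto simp: not_less)
      with dense have "(1::real) \<in> {..0}" by blast
      then show False by simp
    qed
    then obtain n where n: "0 < x n" "\<And>m. m < n \<Longrightarrow> x m \<le> 0"
      using exists_least_iff[of "\<lambda>n. 0 < x n"] by (metis not_le)
    obtain a b where ab: "a < b" "b \<le> 0" "\<And>y. y \<in> x ` {..<n} \<Longrightarrow> \<not> (a < y \<and> y < b)"
      using interval_avoiding_finite[of "x ` {..<n}" 0] by auto
    define stretch where "stretch z = max z (2 * z)" for z :: real
    define f where "f s = bump s a b \<circ> stretch" for s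
    have stretch: "stretch \<in> carrier Homeo_plus"
      by (rule strict_mono_right_inverse_in_Homeo_plus[where g = "\<lambda>y. min y (y / 2)"])
        (auto simp: strict_mono_def stretch_def max_def min_def)
    have f_nonpos: "f s z = bump s a b z" if "z \<le> 0" for s z
      using that by (simp add: f_def stretch_def)
    have f_pos: "f s z = 2 * z" if "0 < z" for s z
      using that ab(2) by (simp add: f_def stretch_def bump_def)
    have sign: "(id, f s) \<in> r \<longleftrightarrow> s = 1" "(id, f s) \<in> r \<longleftrightarrow> \<Omega> n = Plus"
      if s: "s = 1 \<or> s = - 1" for s
    proof -
      have f: "f s \<in> carrier Homeo_plus"
        unfolding f_def using bump_in_Homeo_plus[OF s] stretch by (rule Homeo_plus_comp)
      have neq: "f s z \<noteq> z \<longleftrightarrow> a < z \<and> z < b \<or> 0 < z" for z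
        using f_nonpos[of z s] f_pos[of z s] bump_neq_iff[OF s, of a b z] ab by fastforce
      obtain y where y: "f s y \<noteq> y" and least: "\<And>u. f s u \<noteq> u \<Longrightarrow> (y, u) \<in> w"
        using well_order_on_UNIV_least[OF w, of "\<lambda>u. f s u \<noteq> u" "x n"] neq n(1) by blast
      have "(y, (a + b) / 2) \<in> w"
        using least[of "(a + b) / 2"] neq[of "(a + b) / 2"] ab by (simp add: field_simps)
      then have "y < 0"
        using ab by (auto simp: w_def sorted_by_def split: if_splits)
      then have y': "a < y" "y < b" "f s y = bump s a b y"
        using y neq[of y] f_nonpos[of y s] by simp_all
      have "(id, f s) \<in> r \<longleftrightarrow> y < f s y"
        unfolding r_def
        using gen_dynlex_iff[OF anti_w f id_in_Homeo_plus, of y "\<lambda>_. Plus"] y least by simp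
      then show "(id, f s) \<in> r \<longleftrightarrow> s = 1"
        using s y' bump_less_iff[of a b y] bump_greater_iff[of y a b] by auto
      have "n \<le> m" if "f s (x m) \<noteq> x m" for m
        using that neq ab(3)[of "x m"] n(2)[of m] by (force simp: not_less[symmetric])
      then show "(id, f s) \<in> r \<longleftrightarrow> \<Omega> n = Plus"
        unfolding eq
        using std_dynlex_iff[OF f id_in_Homeo_plus, of x n \<Omega>] n(1) by (simp add: f_pos)
    qed
    from sign[of 1] sign[of "- 1"] show False
      by simp
  qed
  then have "r \<notin> standard_orderings"
    by (auto simp: standard_orderings_def)
  moreover have "r \<in> general_orderings"
    using w by (auto simp: r_def general_orderings_def)
  ultimately show ?thesis ..
qed

section \<open>Preorders at infinity\<close>

text \<open>An ultrafilter is a minimal proper filter. A chain of proper filters has a proper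
  infimum, since an event holds eventually for the infimum only if it does so for a member of the
  chain; so Zorn's lemma provides a minimal one. If \<open>P\<close> is frequent for it, then restricting to
  \<open>P\<close> gives a proper filter below it, hence the same filter, and \<open>P\<close> holds eventually.\<close>

lemma ex_ultrafilter_le:
  assumes "F \<noteq> bot"
  obtains U where "U \<le> F" "U \<noteq> bot" "\<And>P. eventually P U \<or> eventually (\<lambda>x. \<not> P x) U"
proof -
  define A where "A = {H. H \<le> F \<and> H \<noteq> bot}"
  have "\<exists>U\<in>A. \<forall>H\<in>A. H \<le> U \<longrightarrow> H = U"
  proof (rule predicate_Zorn)
    show "partial_order_on A (relation_of (\<lambda>a b. b \<le> a) A)"
      by (auto simp: order_on_defs relation_of_def refl_on_def trans_def antisym_def)
    fix C assume C: "C \<in> Chains (relation_of (\<lambda>a b. b \<le> a) A)"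
    then have CA: "C \<subseteq> A" and tot: "\<And>a b. a \<in> C \<Longrightarrow> b \<in> C \<Longrightarrow> a \<le> b \<or> b \<le> a"
      by (auto simp: Chains_def relation_of_def)
    show "\<exists>u\<in>A. \<forall>a\<in>C. u \<le> a"
    proof (cases "C = {}")
      case True
      then show ?thesis
        using assms by (auto simp: A_def)
    next
      case False
      have "\<exists>x\<in>C. x \<le> inf a b" if "a \<in> C" "b \<in> C" for a b
        using tot[OF that] that by (metis inf.absorb1 inf.absorb2 order_refl)
      then have "eventually P (Inf C) \<longleftrightarrow> (\<exists>b\<in>C. eventually P b)" for P
        using False by (intro eventually_Inf_base) auto
      then have "Inf C \<noteq> bot"
        using CA by (auto simp: trivial_limit_def A_def)
      moreover have "Inf C \<le> F"
        using False CA by (auto simp: A_def intro: Inf_lower2)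
      ultimately show ?thesis
        by (auto simp: A_def intro: Inf_lower)
    qed
  qed
  then obtain U where U: "U \<in> A" "\<And>H. H \<in> A \<Longrightarrow> H \<le> U \<Longrightarrow> H = U"
    by blast
  have "eventually P U" if "\<not> eventually (\<lambda>x. \<not> P x) U" for P
  proof -
    have "inf U (principal {x. P x}) \<in> A"
      using that U(1) by (auto simp: A_def trivial_limit_def eventually_inf_principal intro: le_infI1)
    then have "inf U (principal {x. P x}) = U"
      using U(2) by simp
    moreover have "eventually P (inf U (principal {x. P x}))"
      by (simp add: eventually_inf_principal)
    ultimately show ?thesis
      by simp
  qed
  then show ?thesis
    using that[of U] U(1) by (auto simp: A_def)
qed

text \<open>An ultrafilter \<open>U\<close> below \<^term>\<open>at_top\<close> gives an ultrapower of the line, in which the class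
  \<open>\<xi>\<close> of the identity function is larger than every real number, and on which homeomorphisms act
  preserving the order. In these terms \<open>germ_le\<close> says \<open>f \<xi> \<le> g \<xi>\<close>.\<close>

definition germ_le :: "real filter \<Rightarrow> (real \<Rightarrow> real) \<Rightarrow> (real \<Rightarrow> real) \<Rightarrow> bool" where
  "germ_le U f g \<longleftrightarrow> (\<forall>\<^sub>F x in U. f x \<le> g x)"

text \<open>The galaxy of \<open>\<xi>\<close> consists of the points at finite distance from \<open>\<xi>\<close>; the points \<open>\<xi> + c\<close>
  with \<open>c\<close> real are cofinal in it. So \<open>galaxy_le\<close> says that the cut above the galaxy is not
  mapped higher by \<open>f\<close> than by \<open>g\<close>.\<close>

definition galaxy_le :: "real filter \<Rightarrow> (real \<Rightarrow> real) \<Rightarrow> (real \<Rightarrow> real) \<Rightarrow> bool" where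
  "galaxy_le U f g \<longleftrightarrow> (\<forall>c. \<exists>d. \<forall>\<^sub>F x in U. f (x + c) \<le> g (x + d))"

locale ultrafilter_at_infinity =
  fixes U :: "real filter"
  assumes proper: "U \<noteq> bot" and le_at_top: "U \<le> at_top"
    and ultra: "eventually P U \<or> eventually (\<lambda>x. \<not> P x) U"
begin

lemma eventually_not_iff: "eventually (\<lambda>x. \<not> P x) U \<longleftrightarrow> \<not> eventually P U"
  using ultra[of P] proper by (metis eventually_frequently not_eventually not_frequently)

lemma eventually_large: "eventually (\<lambda>x. c < x) U"
  using le_at_top eventually_gt_at_top[of c] by (rule filter_leD)

lemma left_preorder_germ_le: "left_preorder Homeo_plus (germ_le U)"
  unfolding left_preorder_def
proof (intro conjI ballI impI)
  fix f g :: "real \<Rightarrow> real"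
  show "germ_le U f g \<or> germ_le U g f"
    using ultra[of "\<lambda>x. f x \<le> g x"] eventually_mono[of "\<lambda>x. \<not> f x \<le> g x" U "\<lambda>x. g x \<le> f x"]
    unfolding germ_le_def by auto
next
  fix f g h :: "real \<Rightarrow> real" assume "germ_le U f g" "germ_le U g h"
  then show "germ_le U f h"
    unfolding germ_le_def by eventually_elim simp
next
  fix f g h assume "h \<in> carrier Homeo_plus" "germ_le U f g"
  then show "germ_le U (h \<otimes>\<^bsub>Homeo_plus\<^esub> f) (h \<otimes>\<^bsub>Homeo_plus\<^esub> g)"
    by (simp add: germ_le_def Homeo_plus_le_iff)
qed

lemma left_preorder_galaxy_le: "left_preorder Homeo_plus (galaxy_le U)"
  unfolding left_preorder_def
proof (intro conjI ballI impI)
  fix f g :: "real \<Rightarrow> real"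
  show "galaxy_le U f g \<or> galaxy_le U g f"
  proof (rule disjCI)
    \<comment> \<open>If some \<open>g (\<xi> + c)\<close> lies above all \<open>f (\<xi> + d)\<close>, this one \<open>c\<close> bounds \<open>f\<close> for every
      \<open>d\<close>.\<close>
    assume "\<not> galaxy_le U g f"
    then obtain c where c: "\<And>d. \<forall>\<^sub>F x in U. \<not> g (x + c) \<le> f (x + d)"
      by (auto simp: galaxy_le_def eventually_not_iff)
    have "\<forall>\<^sub>F x in U. f (x + d) \<le> g (x + c)" for d
      using c[of d] by eventually_elim simp
    then show "galaxy_le U f g"
      by (auto simp: galaxy_le_def)
  qed
next
  fix f g h :: "real \<Rightarrow> real" assume fg: "galaxy_le U f g" and gh: "galaxy_le U g h"
  have "\<exists>e. \<forall>\<^sub>F x in U. f (x + c) \<le> h (x + e)" for c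
  proof -
    obtain d where d: "\<forall>\<^sub>F x in U. f (x + c) \<le> g (x + d)"
      using fg by (auto simp: galaxy_le_def)
    obtain e where e: "\<forall>\<^sub>F x in U. g (x + d) \<le> h (x + e)"
      using gh by (auto simp: galaxy_le_def)
    have "\<forall>\<^sub>F x in U. f (x + c) \<le> h (x + e)"
      using d e by eventually_elim simp
    then show ?thesis ..
  qed
  then show "galaxy_le U f h"
    by (simp add: galaxy_le_def)
next
  fix f g h assume "h \<in> carrier Homeo_plus" "galaxy_le U f g"
  then show "galaxy_le U (h \<otimes>\<^bsub>Homeo_plus\<^esub> f) (h \<otimes>\<^bsub>Homeo_plus\<^esub> g)"
    by (simp add: galaxy_le_def Homeo_plus_le_iff)
qed

section \<open>A typical ordering that is not general\<close>

text \<open>Whether \<open>f\<close> moves \<open>\<xi>\<close> up, down or not at all is decided by whether one of the sets of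
  points moved up and of points moved down belongs to the ultrafilter, and which one.\<close>

lemma germ_first_typical:
  assumes r: "r \<in> typical_orderings"
  shows "lex_order Homeo_plus (germ_le U) r \<in> typical_orderings" (is "?r \<in> _")
proof -
  have "left_ordering Homeo_plus ?r"
    using r by (intro left_ordering_lex_order group_Homeo_plus left_preorder_germ_le)
      (simp add: typical_ordering_iff)
  moreover have "((id, f) \<in> ?r \<longleftrightarrow> (id, g) \<in> ?r) \<and>
      ((f, id) \<in> ?r \<longleftrightarrow> (g, id) \<in> ?r)"
    if fg: "f \<in> carrier Homeo_plus" "g \<in> carrier Homeo_plus"
      and sets: "above_set f = above_set g" "below_set f = below_set g" for f g
  proof -
    have "germ_le U id k \<longleftrightarrow> (\<forall>\<^sub>F x in U. x \<notin> below_set k)"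
      "germ_le U k id \<longleftrightarrow> (\<forall>\<^sub>F x in U. x \<notin> above_set k)" for k
      by (simp_all add: germ_le_def below_set_def above_set_def not_less)
    then have "germ_le U id f \<longleftrightarrow> germ_le U id g" "germ_le U f id \<longleftrightarrow> germ_le U g id"
      using sets by simp_all
    moreover have "((id, f) \<in> r \<longleftrightarrow> (id, g) \<in> r) \<and> ((f, id) \<in> r \<longleftrightarrow> (g, id) \<in> r)"
      using r fg sets unfolding typical_ordering_iff by blast
    ultimately show ?thesis
      using fg unfolding lex_order_def by simp
  qed
  ultimately show ?thesis
    unfolding typical_ordering_iff by blast
qed

text \<open>A general ordering gives two maps that both move its least point \<open>y\<close> up the same sign.
  The unit translation does so and moves \<open>\<xi>\<close> up; the contraction by one half towards \<open>y + 1\<close>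
  does so and moves everything beyond \<open>y + 1\<close> down, including \<open>\<xi>\<close>.\<close>

lemma germ_first_not_general:
  "lex_order Homeo_plus (germ_le U) r \<notin> general_orderings"
proof
  assume "lex_order Homeo_plus (germ_le U) r \<in> general_orderings"
  then obtain w \<Omega> where eq: "lex_order Homeo_plus (germ_le U) r = gen_dynlex w \<Omega>"
    and w: "well_order_on UNIV w"
    by (auto simp: general_orderings_def)
  obtain y where y: "\<And>u. (y, u) \<in> w"
    using well_order_on_UNIV_least[OF w, of "\<lambda>_. True"] by auto
  have anti_w: "antisym w"
    using w by (simp add: order_on_defs)
  \<comment> \<open>The contraction is \<open>x \<mapsto> (x + y + 1) / 2\<close>, with fixed point \<open>y + 1\<close>.\<close>
  let ?up = "\<lambda>x. 1 * x + 1 :: real" and ?down = "\<lambda>x. 1 / 2 * x + (y + 1) / 2"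
  have up: "?up \<in> carrier Homeo_plus" and down: "?down \<in> carrier Homeo_plus"
    by (rule affine_in_Homeo_plus, simp)+
  have moved: "y < ?up y" "y < ?down y"
    by (auto simp: field_simps)
  have "(id, ?up) \<in> gen_dynlex w \<Omega> \<longleftrightarrow> \<Omega> y = Plus"
    using gen_dynlex_iff[OF anti_w up id_in_Homeo_plus, of y \<Omega>] y moved(1) by auto
  moreover have "(id, ?down) \<in> gen_dynlex w \<Omega> \<longleftrightarrow> \<Omega> y = Plus"
    using gen_dynlex_iff[OF anti_w down id_in_Homeo_plus, of y \<Omega>] y moved(2) by auto
  moreover have "germ_le U id ?up" "\<not> germ_le U ?up id"
    using proper by (simp_all add: germ_le_def)
  then have "(id, ?up) \<in> lex_order Homeo_plus (germ_le U) r"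
    using up id_in_Homeo_plus by (simp add: lex_order_def)
  moreover have "\<forall>\<^sub>F x in U. \<not> x \<le> ?down x"
    using eventually_large[of "y + 1"] by eventually_elim (simp add: field_simps)
  then have "\<not> germ_le U id ?down"
    by (simp add: germ_le_def eventually_not_iff)
  then have "(id, ?down) \<notin> lex_order Homeo_plus (germ_le U) r"
    by (simp add: lex_order_def)
  ultimately show False
    by (simp add: eq)
qed

section \<open>A left-ordering that is not typical\<close>

text \<open>Both maps below move every point of the line up. The translation preserves the galaxy
  of \<open>\<xi>\<close>, so it is negative by the reversed comparison at \<open>\<xi>\<close>; the other one maps \<open>\<xi>\<close> to
  \<open>2 \<xi>\<close>, beyond the galaxy, and is positive.\<close>

lemma galaxy_first_not_typical:
  "lex_order Homeo_plus (galaxy_le U) (lex_order Homeo_plus (\<lambda>f g. germ_le U g f) r)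
     \<notin> typical_orderings"
    (is "?r \<notin> _")
proof
  assume typical: "?r \<in> typical_orderings"
  let ?shift = "\<lambda>x. 1 * x + 1 :: real" and ?stretch = "\<lambda>x. max (x + 1) (2 * x) :: real"
  have shift: "?shift \<in> carrier Homeo_plus"
    by (rule affine_in_Homeo_plus) simp
  have stretch: "?stretch \<in> carrier Homeo_plus"
    by (rule strict_mono_right_inverse_in_Homeo_plus[where g = "\<lambda>y. min (y - 1) (y / 2)"])
      (auto simp: strict_mono_def max_def min_def)
  have "above_set ?shift = above_set ?stretch" "below_set ?shift = below_set ?stretch"
    by (auto simp: above_set_def below_set_def)
  then have same: "(?shift, id) \<in> ?r \<longleftrightarrow> (?stretch, id) \<in> ?r"
    using typical shift stretch unfolding typical_ordering_iff by blast
  have "\<exists>d. \<forall>\<^sub>F x in U. x + c + 1 \<le> x + d" "\<exists>d. \<forall>\<^sub>F x in U. x + c \<le> x + d + 1" for c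
    by (rule exI[of _ "c + 1"], simp)+
  then have "galaxy_le U ?shift id" "galaxy_le U id ?shift"
    by (simp_all add: galaxy_le_def)
  moreover have "germ_le U id ?shift" "\<not> germ_le U ?shift id"
    using proper by (simp_all add: germ_le_def)
  ultimately have "(?shift, id) \<in> ?r"
    using shift id_in_Homeo_plus by (simp add: lex_order_def)
  moreover have "\<forall>\<^sub>F x in U. \<not> ?stretch (x + 0) \<le> id (x + d)" for d
    using eventually_large[of d] by eventually_elim auto
  then have "\<not> galaxy_le U ?stretch id"
    unfolding galaxy_le_def eventually_not_iff by blast
  then have "(?stretch, id) \<notin> ?r"
    by (simp add: lex_order_def)
  ultimately show False
    using same by simp
qed

end

lemma ex_ultrafilter_at_infinity: "\<exists>U. ultrafilter_at_infinity U"
proof -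
  obtain U :: "real filter" where "U \<le> at_top" "U \<noteq> bot"
    "\<And>P. eventually P U \<or> eventually (\<lambda>x. \<not> P x) U"
    using ex_ultrafilter_le[of "at_top :: real filter"] by auto
  then show ?thesis
    by (auto simp: ultrafilter_at_infinity_def)
qed

theorem theorem3:
  shows "standard_orderings \<subset> general_orderings \<and>
         general_orderings \<subset> typical_orderings \<and>
         typical_orderings \<subset> left_orderings Homeo_plus"
proof -
  obtain U where "ultrafilter_at_infinity U"
    using ex_ultrafilter_at_infinity ..
  then interpret ultrafilter_at_infinity U .
  obtain w :: "real rel" where w: "well_order_on UNIV w"
    using well_order_on by blast
  define r where "r = gen_dynlex w (\<lambda>_. Plus)"
  have "standard_orderings \<subseteq> general_orderings"
    by (auto simp: standard_orderings_def std_dynlex_general)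
  moreover have "general_orderings \<subseteq> typical_orderings"
    by (auto simp: general_orderings_def gen_dynlex_typical)
  moreover have "typical_orderings \<subseteq> left_orderings Homeo_plus"
    by (auto simp: typical_ordering_iff left_orderings_def)
  moreover have "lex_order Homeo_plus (germ_le U) r \<in> typical_orderings"
    unfolding r_def using w by (intro germ_first_typical gen_dynlex_typical)
  moreover have "lex_order Homeo_plus (galaxy_le U)
      (lex_order Homeo_plus (\<lambda>f g. germ_le U g f) r) \<in> left_orderings Homeo_plus"
    unfolding r_def left_orderings_def mem_Collect_eq
    using w by (intro left_ordering_lex_order group_Homeo_plus left_preorder_galaxy_le
        left_preorder_reverse[OF left_preorder_germ_le] left_ordering_gen_dynlex)
  ultimately show ?thesis
    using ex_general_not_standard germ_first_not_general galaxy_first_not_typical by blast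
qed

end
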